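(* Let $\mathrm{Aff}(\mathbb{R})$ be the Lie group of affine transformations of the real line, with a basis $e_1,e_2$ of left invariant vector fields satisfying $[e_1,e_2]=e_2$, and let $D$ be the left invariant linear connection on $\mathrm{Aff}(\mathbb{R})$ defined by $$D_{\lambda e_1+\mu e_2}(\lambda' e_1+\mu' e_2)=\lambda\mu' e_2\qquad(\lambda,\mu,\lambda',\mu'\in\mathbb{R}).$$ Then the locally flat manifold $(\mathrm{Aff}(\mathbb{R}),D)$ admits non trivial deformations.
   Context: A locally flat manifold $(M,D)$ is a smooth manifold $M$ with a torsion free linear connection $D$ whose curvature tensor is zero. The formula for $D$ on left invariant fields is extended to all smooth vector fields as a linear connection; the result is torsion free and flat. A deformation of a locally flat manifold $(M,D)$ is a smooth one-parameter family $D_t$ ($t$ in an open interval containing $0$) of torsion free flat linear connections on $M$ with $D_0=D$. It is non trivial if there are $t$ arbitrarily close to $0$ for which $(M,D_t)$ is not isomorphic to $(M,D)$, where an isomorphism is a diffeomorphism of $M$ carrying one connection to the other. *)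

theory Defs
  imports "HOL-Analysis.Analysis"
begin

text \<open>
  The manifolds considered here are open subsets \<open>U\<close> of a Euclidean space (\<open>Aff(\<real>)\<close> is one, via the
  global chart \<open>(a, b)\<close>), so the tangent space at every point is the ambient space.
\<close>

section \<open>Smooth maps and vector fields on open sets\<close>

text \<open>Intended for open \<open>S\<close>: all iterated directional derivatives up to order \<open>n\<close> exist and are
  continuous.\<close>

primrec Ck_on :: "nat \<Rightarrow> 'a::real_normed_vector set \<Rightarrow> ('a \<Rightarrow> 'b::real_normed_vector) \<Rightarrow> bool" where
  "Ck_on 0 S f \<longleftrightarrow> continuous_on S f"
| "Ck_on (Suc n) S f \<longleftrightarrow>
     (\<forall>x\<in>S. f differentiable (at x)) \<and>
     (\<forall>v. Ck_on n S (\<lambda>x. frechet_derivative f (at x) v))"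

definition smooth_on :: "'a::real_normed_vector set \<Rightarrow> ('a \<Rightarrow> 'b::real_normed_vector) \<Rightarrow> bool" where
  "smooth_on S f \<longleftrightarrow> (\<forall>n. Ck_on n S f)"

text \<open>Vector fields on \<open>U\<close> are represented by total functions vanishing outside \<open>U\<close>, so that equality of
  functions is equality of vector fields on \<open>U\<close>. The value \<open>0\<close> outside \<open>U\<close> is only this convention and
  is not required to fit smoothly at the boundary.\<close>

definition vector_fields :: "'a::euclidean_space set \<Rightarrow> ('a \<Rightarrow> 'a) set" where
  "vector_fields U = {X. smooth_on U X \<and> (\<forall>p. p \<notin> U \<longrightarrow> X p = 0)}"

text \<open>The convention is \<open>[X, Y] f = X (Y f) - Y (X f)\<close>.\<close>

definition lie_bracket ::
  "'a::euclidean_space set \<Rightarrow> ('a \<Rightarrow> 'a) \<Rightarrow> ('a \<Rightarrow> 'a) \<Rightarrow> 'a \<Rightarrow> 'a" where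
  "lie_bracket U X Y = (\<lambda>p. if p \<in> U
     then frechet_derivative Y (at p) (X p) - frechet_derivative X (at p) (Y p) else 0)"

definition diffeo :: "'a::euclidean_space set \<Rightarrow> ('a \<Rightarrow> 'a) \<Rightarrow> bool" where
  "diffeo U \<phi> \<longleftrightarrow> bij_betw \<phi> U U \<and> smooth_on U \<phi> \<and> smooth_on U (inv_into U \<phi>)"

definition pushforward ::
  "'a::euclidean_space set \<Rightarrow> ('a \<Rightarrow> 'a) \<Rightarrow> ('a \<Rightarrow> 'a) \<Rightarrow> 'a \<Rightarrow> 'a" where
  "pushforward U \<phi> X = (\<lambda>q. if q \<in> U
     then frechet_derivative \<phi> (at (inv_into U \<phi> q)) (X (inv_into U \<phi> q)) else 0)"

section \<open>Linear connections\<close>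

type_synonym 'a connection = "('a \<Rightarrow> 'a) \<Rightarrow> ('a \<Rightarrow> 'a) \<Rightarrow> ('a \<Rightarrow> 'a)"

text \<open>\<open>D X Y\<close> is the covariant derivative of \<open>Y\<close> along \<open>X\<close>. Only the values on
  \<^term>\<open>vector_fields U\<close> are meaningful.\<close>

definition linear_connection :: "'a::euclidean_space set \<Rightarrow> 'a connection \<Rightarrow> bool" where
  "linear_connection U D \<longleftrightarrow>
     (\<forall>X\<in>vector_fields U. \<forall>Y\<in>vector_fields U. D X Y \<in> vector_fields U) \<and>
     (\<forall>X\<in>vector_fields U. \<forall>X'\<in>vector_fields U. \<forall>Y\<in>vector_fields U.
        D (\<lambda>p. X p + X' p) Y = (\<lambda>p. D X Y p + D X' Y p)) \<and>
     (\<forall>X\<in>vector_fields U. \<forall>Y\<in>vector_fields U. \<forall>Y'\<in>vector_fields U.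
        D X (\<lambda>p. Y p + Y' p) = (\<lambda>p. D X Y p + D X Y' p)) \<and>
     (\<forall>f::'a \<Rightarrow> real. smooth_on U f \<longrightarrow> (\<forall>X\<in>vector_fields U. \<forall>Y\<in>vector_fields U.
        D (\<lambda>p. f p *\<^sub>R X p) Y = (\<lambda>p. f p *\<^sub>R D X Y p) \<and>
        D X (\<lambda>p. f p *\<^sub>R Y p) =
          (\<lambda>p. frechet_derivative f (at p) (X p) *\<^sub>R Y p + f p *\<^sub>R D X Y p)))"

definition torsion ::
  "'a::euclidean_space set \<Rightarrow> 'a connection \<Rightarrow> ('a \<Rightarrow> 'a) \<Rightarrow> ('a \<Rightarrow> 'a) \<Rightarrow> 'a \<Rightarrow> 'a" where
  "torsion U D X Y = (\<lambda>p. D X Y p - D Y X p - lie_bracket U X Y p)"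

definition curvature ::
  "'a::euclidean_space set \<Rightarrow> 'a connection \<Rightarrow>
     ('a \<Rightarrow> 'a) \<Rightarrow> ('a \<Rightarrow> 'a) \<Rightarrow> ('a \<Rightarrow> 'a) \<Rightarrow> 'a \<Rightarrow> 'a" where
  "curvature U D X Y Z =
     (\<lambda>p. D X (D Y Z) p - D Y (D X Z) p - D (lie_bracket U X Y) Z p)"

definition locally_flat_manifold :: "'a::euclidean_space set \<Rightarrow> 'a connection \<Rightarrow> bool" where
  "locally_flat_manifold U D \<longleftrightarrow>
     open U \<and> linear_connection U D \<and>
     (\<forall>X\<in>vector_fields U. \<forall>Y\<in>vector_fields U. torsion U D X Y = (\<lambda>p. 0)) \<and>
     (\<forall>X\<in>vector_fields U. \<forall>Y\<in>vector_fields U. \<forall>Z\<in>vector_fields U.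
        curvature U D X Y Z = (\<lambda>p. 0))"

definition carries_connection ::
  "'a::euclidean_space set \<Rightarrow> ('a \<Rightarrow> 'a) \<Rightarrow> 'a connection \<Rightarrow> 'a connection \<Rightarrow> bool" where
  "carries_connection U \<phi> D D' \<longleftrightarrow>
     (\<forall>X\<in>vector_fields U. \<forall>Y\<in>vector_fields U.
        D' (pushforward U \<phi> X) (pushforward U \<phi> Y) = pushforward U \<phi> (D X Y))"

definition isomorphic_connections ::
  "'a::euclidean_space set \<Rightarrow> 'a connection \<Rightarrow> 'a connection \<Rightarrow> bool" where
  "isomorphic_connections U D D' \<longleftrightarrow> (\<exists>\<phi>. diffeo U \<phi> \<and> carries_connection U \<phi> D D')"

section \<open>Deformations\<close>

definition smooth_connection_family ::
  "'a::euclidean_space set \<Rightarrow> real set \<Rightarrow> (real \<Rightarrow> 'a connection) \<Rightarrow> bool" where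
  "smooth_connection_family U I Dt \<longleftrightarrow>
     (\<forall>X\<in>vector_fields U. \<forall>Y\<in>vector_fields U. smooth_on (I \<times> U) (\<lambda>(t, p). Dt t X Y p))"

definition deformation ::
  "'a::euclidean_space set \<Rightarrow> 'a connection \<Rightarrow> real set \<Rightarrow> (real \<Rightarrow> 'a connection) \<Rightarrow> bool" where
  "deformation U D I Dt \<longleftrightarrow>
     open I \<and> is_interval I \<and> 0 \<in> I \<and>
     smooth_connection_family U I Dt \<and>
     (\<forall>t\<in>I. locally_flat_manifold U (Dt t)) \<and>
     (\<forall>X\<in>vector_fields U. \<forall>Y\<in>vector_fields U. Dt 0 X Y = D X Y)"

definition nontrivial_deformation ::
  "'a::euclidean_space set \<Rightarrow> 'a connection \<Rightarrow> real set \<Rightarrow> (real \<Rightarrow> 'a connection) \<Rightarrow> bool" where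
  "nontrivial_deformation U D I Dt \<longleftrightarrow>
     deformation U D I Dt \<and>
     (\<forall>\<epsilon>>0. \<exists>t\<in>I. \<bar>t\<bar> < \<epsilon> \<and> \<not> isomorphic_connections U (Dt t) D)"

section \<open>The affine group of the real line\<close>

text \<open>The pair \<open>(a, b)\<close> with \<open>a \<noteq> 0\<close> stands for the transformation \<open>x \<mapsto> a x + b\<close>; the group has two
  connected components.\<close>

definition Aff :: "(real \<times> real) set" where
  "Aff = {(a, b). a \<noteq> 0}"

definition aff_map :: "real \<times> real \<Rightarrow> real \<Rightarrow> real" where
  "aff_map g x = fst g * x + snd g"

definition aff_mult :: "real \<times> real \<Rightarrow> real \<times> real \<Rightarrow> real \<times> real" where
  "aff_mult g h = (fst g * fst h, fst g * snd h + snd g)"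

lemma aff_map_mult: "aff_map (aff_mult g h) = aff_map g \<circ> aff_map h"
  by (rule ext) (simp add: aff_map_def aff_mult_def algebra_simps)

lemma bij_betw_aff_map:
  "bij_betw aff_map Aff {f. bij f \<and> (\<exists>a b. \<forall>x. f x = a * x + b)}"
proof (rule bij_betwI')
  fix g h
  show "aff_map g = aff_map h \<longleftrightarrow> g = h"
  proof
    assume *: "aff_map g = aff_map h"
    show "g = h"
      using fun_cong[OF *, of 0] fun_cong[OF *, of 1]
      by (simp add: aff_map_def prod_eq_iff)
  qed simp
next
  fix g assume "g \<in> Aff"
  then have a: "fst g \<noteq> 0" by (auto simp: Aff_def)
  have "bij (aff_map g)"
    by (rule o_bij[where g = "\<lambda>y. (y - snd g) / fst g"])
      (use a in \<open>auto simp: aff_map_def fun_eq_iff\<close>)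
  then show "aff_map g \<in> {f. bij f \<and> (\<exists>a b. \<forall>x. f x = a * x + b)}"
    by (auto simp: aff_map_def)
next
  fix f :: "real \<Rightarrow> real"
  assume "f \<in> {f. bij f \<and> (\<exists>a b. \<forall>x. f x = a * x + b)}"
  then obtain a b where f: "bij f" "\<And>x. f x = a * x + b" by auto
  have "a \<noteq> 0"
  proof
    assume "a = 0"
    then have "f 0 = f 1" using f by simp
    then show False using bij_is_inj[OF f(1)] by (metis injD zero_neq_one)
  qed
  then show "\<exists>g\<in>Aff. f = aff_map g"
    using f(2) by (intro bexI[of _ "(a, b)"]) (auto simp: Aff_def aff_map_def)
qed

definition left_invariant_fields :: "(real \<times> real \<Rightarrow> real \<times> real) set" where
  "left_invariant_fields =
     {X \<in> vector_fields Aff. \<forall>g\<in>Aff. pushforward Aff (aff_mult g) X = X}"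

definition left_invariant_basis ::
  "(real \<times> real \<Rightarrow> real \<times> real) \<Rightarrow> (real \<times> real \<Rightarrow> real \<times> real) \<Rightarrow> bool" where
  "left_invariant_basis e1 e2 \<longleftrightarrow>
     e1 \<in> left_invariant_fields \<and> e2 \<in> left_invariant_fields \<and>
     (\<forall>c d. (\<lambda>p. c *\<^sub>R e1 p + d *\<^sub>R e2 p) = (\<lambda>p. 0) \<longrightarrow> c = 0 \<and> d = 0) \<and>
     (\<forall>X\<in>left_invariant_fields. \<exists>c d. X = (\<lambda>p. c *\<^sub>R e1 p + d *\<^sub>R e2 p))"

definition left_invariant_connection :: "(real \<times> real) connection \<Rightarrow> bool" where
  "left_invariant_connection D \<longleftrightarrow>
     linear_connection Aff D \<and> (\<forall>g\<in>Aff. carries_connection Aff (aff_mult g) D D)"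

end

theory Submission
  imports Defs
begin

text \<open>
  In the chart \<open>(a, b)\<close> a left invariant field is \<open>a\<close> times a constant vector, and the relation
  \<open>[e\<^sub>1, e\<^sub>2] = e\<^sub>2\<close> forces \<open>e\<^sub>1 = a (1, \<alpha>)\<close> and \<open>e\<^sub>2 = a (0, \<beta>)\<close> with \<open>\<beta> \<noteq> 0\<close>
  (\<open>left_invariant_basis_coordinates\<close>). The given connection is then
  \<open>D\<^sub>X Y = dY(X) - (X\<^sub>1 Y\<^sub>1 / a) (1, \<alpha>)\<close> (\<open>connection_eq_aff_connection\<close>): each component of the group
  is an affine plane with coordinates \<open>(ln \<bar>a\<bar>, b - \<alpha> a)\<close>, so \<open>D\<close> is flat and geodesically complete.

  The deformation multiplies the correction term by \<open>1 - t\<close>. The result is still flat and torsion free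
  (\<open>locally_flat_aff_connection\<close>), but for \<open>t \<noteq> 0\<close> the first affine coordinate becomes \<open>\<bar>a\<bar>\<^sup>t\<close>,
  which is bounded below: each component is now an affine half-plane. A positive function that is affine
  along a complete geodesic is constant along it, so the deformed connection is incomplete
  (\<open>incomplete_geodesic\<close>), whereas an isomorphism would transport the complete geodesics of \<open>D\<close> to it
  (\<open>not_isomorphic_aff_connection\<close>). Hence no \<open>D\<^sub>t\<close> with \<open>t \<noteq> 0\<close> is isomorphic to \<open>D\<close>.

  Flatness rests on the symmetry of second derivatives, and the construction of the connections and of
  pullbacks on closure properties of smooth maps; both are derived from the recursive description of
  \<^const>\<open>Ck_on\<close>.
\<close>

section \<open>Calculus of smooth maps\<close>

lemma Ck_on_cong_imp:
  assumes "open S" "Ck_on n S f" "\<And>x. x \<in> S \<Longrightarrow> f x = g x"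
  shows "Ck_on n S g"
  using assms(2,3)
proof (induction n arbitrary: f g)
  case 0
  then show ?case using continuous_on_cong[of S S f g] by simp
next
  case (Suc n)
  have d: "(g has_derivative frechet_derivative f (at x)) (at x)" if "x \<in> S" for x
    by (rule has_derivative_transform_within_open[OF _ assms(1) that Suc.prems(2)])
      (use Suc.prems(1) that in \<open>simp_all add: frechet_derivative_works[symmetric]\<close>)
  have e: "frechet_derivative g (at x) = frechet_derivative f (at x)" if "x \<in> S" for x
    using frechet_derivative_at[OF d[OF that]] by simp
  have "Ck_on n S (\<lambda>x. frechet_derivative g (at x) v)" for v
    by (rule Suc.IH[of "\<lambda>x. frechet_derivative f (at x) v"]) (use Suc.prems(1) e in auto)
  then show ?case using d by (auto simp: differentiable_def)
qed

text \<open>The working form of the recursion for \<^const>\<open>Ck_on\<close>: any explicit formula for the derivative may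
  take the place of the chosen Frechet derivative, which is otherwise hard to rewrite.\<close>

lemma Ck_on_SucI:
  assumes "open S" "\<And>x. x \<in> S \<Longrightarrow> (f has_derivative F x) (at x)"
    and "\<And>v. Ck_on n S (\<lambda>x. F x v)"
  shows "Ck_on (Suc n) S f"
proof -
  have "Ck_on n S (\<lambda>x. frechet_derivative f (at x) v)" for v
    by (rule Ck_on_cong_imp[OF assms(1) assms(3)[of v]])
      (simp add: frechet_derivative_at[OF assms(2), symmetric])
  then show ?thesis using assms(2) by (auto simp: differentiable_def)
qed

lemma Ck_on_has_derivative:
  "Ck_on (Suc n) S f \<Longrightarrow> x \<in> S \<Longrightarrow> (f has_derivative frechet_derivative f (at x)) (at x)"
  by (simp add: frechet_derivative_works[symmetric])

lemma Ck_on_SucD: "Ck_on (Suc n) S f \<Longrightarrow> Ck_on n S f"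
proof (induction n arbitrary: f)
  case 0
  then show ?case
    by (auto intro!: continuous_at_imp_continuous_on differentiable_imp_continuous_within)
next
  case (Suc n)
  then show ?case by (metis Ck_on.simps(2))
qed

lemma Ck_on_const: "open S \<Longrightarrow> Ck_on n S (\<lambda>x. c)"
proof (induction n arbitrary: c)
  case (Suc n)
  show ?case by (rule Ck_on_SucI[where F = "\<lambda>x v. 0"]) (use Suc in auto)
qed simp

lemma Ck_on_linear:
  assumes "open S" "bounded_linear L"
  shows "Ck_on n S L"
proof (cases n)
  case 0
  then show ?thesis using assms(2) by (simp add: linear_continuous_on)
next
  case (Suc m)
  show ?thesis unfolding Suc
    by (rule Ck_on_SucI[where F = "\<lambda>x v. L v"])
      (use assms in \<open>auto intro: bounded_linear_imp_has_derivative Ck_on_const\<close>)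
qed

lemma Ck_on_add:
  assumes "open S"
  shows "Ck_on n S f \<Longrightarrow> Ck_on n S g \<Longrightarrow> Ck_on n S (\<lambda>x. f x + g x)"
proof (induction n arbitrary: f g)
  case 0
  then show ?case by (simp add: continuous_on_add)
next
  case (Suc n)
  show ?case
  proof (rule Ck_on_SucI[OF assms])
    show "((\<lambda>x. f x + g x) has_derivative
        (\<lambda>v. frechet_derivative f (at x) v + frechet_derivative g (at x) v)) (at x)"
      if "x \<in> S" for x
      by (intro has_derivative_add Ck_on_has_derivative[OF Suc.prems(1) that]
          Ck_on_has_derivative[OF Suc.prems(2) that])
  qed (use Suc in auto)
qed

lemma Ck_on_sum:
  assumes "open S" "\<And>i. i \<in> A \<Longrightarrow> Ck_on n S (f i)"
  shows "Ck_on n S (\<lambda>x. \<Sum>i\<in>A. f i x)"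
proof (cases "finite A")
  case True
  then show ?thesis using assms(2)
    by (induction A) (auto intro: Ck_on_const Ck_on_add assms(1))
qed (simp add: Ck_on_const assms(1))

text \<open>The product rule expresses the derivative by products of one order less, which is the induction.\<close>

lemma Ck_on_bilinear:
  assumes "open S" "bounded_bilinear B"
  shows "Ck_on n S f \<Longrightarrow> Ck_on n S g \<Longrightarrow> Ck_on n S (\<lambda>x. B (f x) (g x))"
proof (induction n arbitrary: f g)
  case 0
  then show ?case using bounded_bilinear.continuous_on[OF assms(2)] by auto
next
  case (Suc n)
  show ?case
  proof (rule Ck_on_SucI[OF assms(1)])
    show "((\<lambda>x. B (f x) (g x)) has_derivative
        (\<lambda>v. B (f x) (frechet_derivative g (at x) v) + B (frechet_derivative f (at x) v) (g x))) (at x)"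
      if "x \<in> S" for x
      by (intro bounded_bilinear.FDERIV[OF assms(2)] Ck_on_has_derivative[OF Suc.prems(1) that]
          Ck_on_has_derivative[OF Suc.prems(2) that])
    show "Ck_on n S (\<lambda>x. B (f x) (frechet_derivative g (at x) v) + B (frechet_derivative f (at x) v) (g x))" for v
      by (intro Ck_on_add Suc.IH assms(1) Ck_on_SucD[OF Suc.prems(1)] Ck_on_SucD[OF Suc.prems(2)])
        (use Suc.prems in auto)
  qed
qed

lemma linear_euclidean_expansion:
  fixes L :: "'a::euclidean_space \<Rightarrow> 'b::real_normed_vector"
  assumes "linear L"
  shows "L v = (\<Sum>b\<in>Basis. (v \<bullet> b) *\<^sub>R L b)"
proof -
  have "L v = L (\<Sum>b\<in>Basis. (v \<bullet> b) *\<^sub>R b)" by (simp add: euclidean_representation)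
  also have "\<dots> = (\<Sum>b\<in>Basis. (v \<bullet> b) *\<^sub>R L b)"
    by (simp add: linear_sum[OF assms] linear_cmul[OF assms])
  finally show ?thesis .
qed

lemma Ck_on_linear_compose:
  assumes "open S" "bounded_linear L" "Ck_on n S f"
  shows "Ck_on n S (\<lambda>x. L (f x))"
  using assms(3)
proof (induction n arbitrary: f)
  case 0
  then show ?case using bounded_linear.continuous_on[OF assms(2)] by auto
next
  case (Suc n)
  show ?case
  proof (rule Ck_on_SucI[OF assms(1)])
    show "((\<lambda>x. L (f x)) has_derivative (\<lambda>v. L (frechet_derivative f (at x) v))) (at x)"
      if "x \<in> S" for x
      by (intro bounded_linear.has_derivative[OF assms(2)] Ck_on_has_derivative[OF Suc.prems that])
  qed (use Suc in auto)
qed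

text \<open>The chain rule puts \<open>f x\<close> and the direction \<open>f' x v\<close> into one term \<open>g' (f x) (f' x v)\<close>, which is not
  of the form covered by the induction hypothesis. Expanding the direction in an orthonormal basis
  separates the two: each summand is a product of a function of the form \<open>g' (_) b \<circ> f\<close>
  with a coordinate of \<open>f'\<close>.\<close>

lemma Ck_on_compose:
  fixes g :: "'b::euclidean_space \<Rightarrow> 'c::real_normed_vector"
  assumes "open S" "\<And>x. x \<in> S \<Longrightarrow> f x \<in> T"
  shows "Ck_on n T g \<Longrightarrow> Ck_on n S f \<Longrightarrow> Ck_on n S (\<lambda>x. g (f x))"
  using assms(2)
proof (induction n arbitrary: f g)
  case 0
  then show ?case using continuous_on_compose2[of T g S f] by auto
next
  case (Suc n)
  let ?g' = "\<lambda>y. frechet_derivative g (at y)" and ?f' = "\<lambda>x. frechet_derivative f (at x)"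
  show ?case
  proof (rule Ck_on_SucI[OF assms(1)])
    fix x assume x: "x \<in> S"
    have g: "(g has_derivative ?g' (f x)) (at (f x))"
      by (rule Ck_on_has_derivative[OF Suc.prems(1)]) (use Suc.prems x in auto)
    have "((\<lambda>x. g (f x)) has_derivative (\<lambda>v. ?g' (f x) (?f' x v))) (at x)"
      using diff_chain_at[OF Ck_on_has_derivative[OF Suc.prems(2) x] g] by (simp add: o_def)
    also have "(\<lambda>v. ?g' (f x) (?f' x v)) = (\<lambda>v. \<Sum>b\<in>Basis. (?f' x v \<bullet> b) *\<^sub>R ?g' (f x) b)"
      by (rule ext, rule linear_euclidean_expansion, rule has_derivative_linear[OF g])
    finally show "((\<lambda>x. g (f x)) has_derivative
      (\<lambda>v. \<Sum>b\<in>Basis. (?f' x v \<bullet> b) *\<^sub>R ?g' (f x) b)) (at x)" .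
  next
    show "Ck_on n S (\<lambda>x. \<Sum>b\<in>Basis. (?f' x v \<bullet> b) *\<^sub>R ?g' (f x) b)" for v
    proof (intro Ck_on_sum Ck_on_bilinear[OF _ bounded_bilinear_scaleR] assms(1))
      fix b :: 'b
      show "Ck_on n S (\<lambda>x. ?f' x v \<bullet> b)"
        by (rule Ck_on_linear_compose[OF assms(1) bounded_linear_inner_left]) (use Suc.prems in auto)
      show "Ck_on n S (\<lambda>x. ?g' (f x) b)"
        by (rule Suc.IH) (use Suc.prems Ck_on_SucD[OF Suc.prems(2)] in auto)
    qed
  qed
qed

text \<open>The derivative \<open>- v / x\<^sup>2\<close> is a product of two copies of the function itself.\<close>

lemma Ck_on_inverse: "Ck_on n {x. x \<noteq> 0} (inverse :: real \<Rightarrow> real)"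
proof (induction n)
  case 0
  show ?case by (auto intro: continuous_intros)
next
  case (Suc n)
  have o: "open {x::real. x \<noteq> 0}" by (intro open_Collect_neq continuous_intros)
  show ?case
  proof (rule Ck_on_SucI[OF o])
    show "(inverse has_derivative (\<lambda>v. (inverse x * inverse x) * (- v))) (at x)" if "x \<in> {x. x \<noteq> 0}" for x :: real
      using has_derivative_inverse'[of x UNIV] that by (simp add: ac_simps)
    show "Ck_on n {x::real. x \<noteq> 0} (\<lambda>x. (inverse x * inverse x) * (- v))" for v
      by (intro Ck_on_bilinear[OF o bounded_bilinear_mult] Suc Ck_on_const o)
  qed
qed

lemma smooth_onD: "smooth_on S f \<Longrightarrow> Ck_on n S f"
  by (simp add: smooth_on_def)

lemma smooth_on_has_derivative:
  "smooth_on S f \<Longrightarrow> x \<in> S \<Longrightarrow> (f has_derivative frechet_derivative f (at x)) (at x)"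
  by (metis Ck_on_has_derivative smooth_onD)

lemma smooth_on_cong:
  "open S \<Longrightarrow> smooth_on S f \<Longrightarrow> (\<And>x. x \<in> S \<Longrightarrow> f x = g x) \<Longrightarrow> smooth_on S g"
  by (metis Ck_on_cong_imp smooth_on_def)

lemma smooth_on_const: "open S \<Longrightarrow> smooth_on S (\<lambda>x. c)"
  by (simp add: smooth_on_def Ck_on_const)

lemma smooth_on_linear: "open S \<Longrightarrow> bounded_linear L \<Longrightarrow> smooth_on S L"
  by (simp add: smooth_on_def Ck_on_linear)

lemma smooth_on_add:
  "open S \<Longrightarrow> smooth_on S f \<Longrightarrow> smooth_on S g \<Longrightarrow> smooth_on S (\<lambda>x. f x + g x)"
  by (simp add: smooth_on_def Ck_on_add)

lemma smooth_on_scaleR: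
  "open S \<Longrightarrow> smooth_on S f \<Longrightarrow> smooth_on S g \<Longrightarrow> smooth_on S (\<lambda>x. f x *\<^sub>R g x)"
  by (simp add: smooth_on_def Ck_on_bilinear[OF _ bounded_bilinear_scaleR])

lemma smooth_on_mult:
  fixes f g :: "_ \<Rightarrow> real"
  shows "open S \<Longrightarrow> smooth_on S f \<Longrightarrow> smooth_on S g \<Longrightarrow> smooth_on S (\<lambda>x. f x * g x)"
  by (simp add: smooth_on_def Ck_on_bilinear[OF _ bounded_bilinear_mult])

lemma smooth_on_linear_compose:
  "open S \<Longrightarrow> bounded_linear L \<Longrightarrow> smooth_on S f \<Longrightarrow> smooth_on S (\<lambda>x. L (f x))"
  by (simp add: smooth_on_def Ck_on_linear_compose)

lemma smooth_on_diff:
  assumes "open S" "smooth_on S f" "smooth_on S g"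
  shows "smooth_on S (\<lambda>x. f x - g x)"
  using smooth_on_add[OF assms(1,2) smooth_on_linear_compose[OF assms(1) bounded_linear_minus[OF bounded_linear_ident] assms(3)]]
  by simp

lemma smooth_on_sum:
  "open S \<Longrightarrow> (\<And>i. i \<in> A \<Longrightarrow> smooth_on S (f i)) \<Longrightarrow> smooth_on S (\<lambda>x. \<Sum>i\<in>A. f i x)"
  by (simp add: smooth_on_def Ck_on_sum)

lemma smooth_on_compose:
  fixes g :: "'b::euclidean_space \<Rightarrow> 'c::real_normed_vector"
  shows "open S \<Longrightarrow> smooth_on T g \<Longrightarrow> smooth_on S f \<Longrightarrow> (\<And>x. x \<in> S \<Longrightarrow> f x \<in> T) \<Longrightarrow>
    smooth_on S (\<lambda>x. g (f x))"
  unfolding smooth_on_def by (blast intro: Ck_on_compose)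

lemma smooth_on_inverse:
  "open S \<Longrightarrow> smooth_on S f \<Longrightarrow> (\<And>x. x \<in> S \<Longrightarrow> f x \<noteq> 0) \<Longrightarrow> smooth_on S (\<lambda>x. inverse (f x :: real))"
  by (rule smooth_on_compose[where T = "{x. x \<noteq> 0}"]) (auto simp: smooth_on_def Ck_on_inverse)

lemma smooth_on_frechet_derivative:
  "smooth_on S f \<Longrightarrow> smooth_on S (\<lambda>x. frechet_derivative f (at x) v)"
  by (metis Ck_on.simps(2) smooth_on_def)

lemma smooth_on_frechet_derivative_apply:
  fixes g :: "'b::euclidean_space \<Rightarrow> 'c::real_normed_vector"
  assumes "open S" "smooth_on T g" "smooth_on S f" "\<And>x. x \<in> S \<Longrightarrow> f x \<in> T" "smooth_on S X"
  shows "smooth_on S (\<lambda>x. frechet_derivative g (at (f x)) (X x))"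
proof (rule smooth_on_cong[OF assms(1)])
  show "smooth_on S (\<lambda>x. \<Sum>b\<in>Basis. (X x \<bullet> b) *\<^sub>R frechet_derivative g (at (f x)) b)"
    by (intro smooth_on_sum smooth_on_scaleR smooth_on_linear_compose[OF _ bounded_linear_inner_left]
        smooth_on_compose[OF _ smooth_on_frechet_derivative[OF assms(2)]] assms)
  show "(\<Sum>b\<in>Basis. (X x \<bullet> b) *\<^sub>R frechet_derivative g (at (f x)) b) = frechet_derivative g (at (f x)) (X x)"
    if "x \<in> S" for x
    by (rule linear_euclidean_expansion[symmetric],
        rule has_derivative_linear[OF smooth_on_has_derivative[OF assms(2) assms(4)[OF that]]])
qed

section \<open>Symmetry of second derivatives\<close>

text \<open>The mean value theorem in the first and then in the second variable. The left-hand side does not depend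
  on the order in which the two variables are treated; this is the whole reason for the symmetry
  of second derivatives below.\<close>

lemma second_difference_mvt:
  fixes f g k :: "real \<Rightarrow> real \<Rightarrow> real"
  assumes "h > 0"
    and "\<And>s t. s \<in> {0..h} \<Longrightarrow> t \<in> {0..h} \<Longrightarrow> ((\<lambda>s. f s t) has_real_derivative g s t) (at s)"
    and "\<And>s t. s \<in> {0..h} \<Longrightarrow> t \<in> {0..h} \<Longrightarrow> ((\<lambda>t. g s t) has_real_derivative k s t) (at t)"
  shows "\<exists>s\<in>{0..h}. \<exists>t\<in>{0..h}. f h h - f h 0 - f 0 h + f 0 0 = h * h * k s t"
proof -
  have "\<exists>s>0. s < h \<and> (f h h - f h 0) - (f 0 h - f 0 0) = (h - 0) * (g s h - g s 0)"
    using assms(1)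
    by (intro MVT2[of 0 h "\<lambda>s. f s h - f s 0"] DERIV_diff assms(2)) auto
  then obtain s where s: "0 < s" "s < h"
    and s': "(f h h - f h 0) - (f 0 h - f 0 0) = h * (g s h - g s 0)" by auto
  have "\<exists>t>0. t < h \<and> g s h - g s 0 = (h - 0) * k s t"
    using assms(1) s by (intro MVT2[of 0 h "\<lambda>t. g s t"] assms(3)) auto
  then obtain t where "0 < t" "t < h" "g s h - g s 0 = h * k s t" by auto
  then show ?thesis using s s' by (intro bexI[of _ s] bexI[of _ t]) (auto simp: algebra_simps)
qed

lemma has_real_derivative_along_line:
  fixes f :: "'a::real_normed_vector \<Rightarrow> real"
  assumes "(f has_derivative F) (at (p + s *\<^sub>R u))"
  shows "((\<lambda>s. f (p + s *\<^sub>R u)) has_real_derivative F u) (at s)"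
proof -
  have "((\<lambda>s. p + s *\<^sub>R u) has_derivative (\<lambda>r. r *\<^sub>R u)) (at s)"
    by (auto intro!: derivative_eq_intros)
  from diff_chain_at[OF this assms]
  have "((\<lambda>s. f (p + s *\<^sub>R u)) has_derivative (\<lambda>r. F (r *\<^sub>R u))) (at s)" by (simp add: o_def)
  moreover have "F (r *\<^sub>R u) = F u * r" for r
    using linear_cmul[OF has_derivative_linear[OF assms]] by simp
  ultimately show ?thesis by (simp add: has_field_derivative_def mult_commute_abs)
qed

text \<open>If the two mixed derivatives differed at \<open>p\<close> by \<open>2 e\<close>, then on a small parallelogram spanned
  by \<open>u\<close> and \<open>v\<close> each would stay within \<open>e\<close> of its value at \<open>p\<close>. But the second difference
  over that parallelogram is \<open>h\<^sup>2\<close> times a value of either one.\<close>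

lemma second_derivative_symmetric_real:
  fixes f :: "'a::real_normed_vector \<Rightarrow> real"
  assumes S: "open S" "p \<in> S" and f: "Ck_on 2 S f"
  defines "d \<equiv> \<lambda>u v x. frechet_derivative (\<lambda>y. frechet_derivative f (at y) u) (at x) v"
  shows "d u v p = d v u p"
proof (rule ccontr)
  assume ne: "d u v p \<noteq> d v u p"
  define e where "e = \<bar>d u v p - d v u p\<bar> / 2"
  have e: "e > 0" using ne by (simp add: e_def)
  have C1: "Ck_on (Suc 0) S (\<lambda>y. frechet_derivative f (at y) w)" for w
    using f by (simp add: numeral_2_eq_2)
  have "continuous_on S (d w z)" for w z using C1[of w] by (simp add: d_def)
  then have cont: "isCont (d w z) p" for w z
    using S continuous_on_eq_continuous_at by blast
  have "\<forall>\<^sub>F x in nhds p. dist (d w z x) (d w z p) < e" for w z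
    using cont[of w z] e by (simp add: isCont_def tendsto_at_iff_tendsto_nhds tendstoD)
  then have "\<forall>\<^sub>F x in nhds p. x \<in> S \<and> dist (d u v x) (d u v p) < e \<and> dist (d v u x) (d v u p) < e"
    by (intro eventually_conj eventually_nhds_in_open S)
  then obtain r where r: "r > 0"
    and near: "\<And>x. dist x p < r \<Longrightarrow> x \<in> S \<and> dist (d u v x) (d u v p) < e \<and> dist (d v u x) (d v u p) < e"
    unfolding eventually_nhds_metric by blast
  \<comment> \<open>The summand 1 keeps the denominator positive when \<open>u\<close> and \<open>v\<close> vanish; the factor 2 makes the
    parallelogram lie strictly inside the ball of radius \<open>r\<close>.\<close>
  define h where "h = r / (2 * (norm u + norm v + 1))"
  have den: "0 < 2 * (norm u + norm v + 1)"
    by (smt (verit) norm_ge_zero)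
  have h: "h > 0" unfolding h_def using r den by simp
  have small: "dist (p + s *\<^sub>R a + t *\<^sub>R b) p < r"
    if "s \<in> {0..h}" "t \<in> {0..h}" "{a, b} = {u, v}" for s t a b
  proof -
    have "dist (p + s *\<^sub>R a + t *\<^sub>R b) p \<le> norm (s *\<^sub>R a) + norm (t *\<^sub>R b)"
      using norm_triangle_ineq[of "s *\<^sub>R a" "t *\<^sub>R b"] by (simp add: dist_norm add.assoc)
    also have "\<dots> \<le> h * norm a + h * norm b"
      using that h by (auto intro!: add_mono mult_right_mono)
    also have "\<dots> = h * (norm u + norm v)"
      using that(3) by (auto simp: doubleton_eq_iff algebra_simps)
    also have "\<dots> < h * (2 * (norm u + norm v + 1))"
      using h by (intro mult_strict_left_mono) (smt (verit) norm_ge_zero)+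
    also have "\<dots> = r" unfolding h_def using den by simp
    finally show ?thesis .
  qed
  have D: "\<exists>s\<in>{0..h}. \<exists>t\<in>{0..h}.
      f (p + h *\<^sub>R a + h *\<^sub>R b) - f (p + h *\<^sub>R a + 0 *\<^sub>R b) - f (p + 0 *\<^sub>R a + h *\<^sub>R b) + f (p + 0 *\<^sub>R a + 0 *\<^sub>R b)
        = h * h * d a b (p + s *\<^sub>R a + t *\<^sub>R b)"
    if ab: "{a, b} = {u, v}" for a b
  proof (rule second_difference_mvt[OF h, where g = "\<lambda>s t. frechet_derivative f (at (p + s *\<^sub>R a + t *\<^sub>R b)) a"])
    fix s t assume st: "s \<in> {0..h}" "t \<in> {0..h}"
    have x: "p + s *\<^sub>R a + t *\<^sub>R b \<in> S" using near small[OF st ab] by blast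
    have x': "p + t *\<^sub>R b + s *\<^sub>R a \<in> S" using x by (simp add: ac_simps)
    show "((\<lambda>s. f (p + s *\<^sub>R a + t *\<^sub>R b)) has_real_derivative
        frechet_derivative f (at (p + s *\<^sub>R a + t *\<^sub>R b)) a) (at s)"
      using has_real_derivative_along_line[of f _ "p + t *\<^sub>R b", OF Ck_on_has_derivative[OF _ x', of 1]] f
      by (simp add: numeral_2_eq_2 ac_simps del: Ck_on.simps)
    show "((\<lambda>t. frechet_derivative f (at (p + s *\<^sub>R a + t *\<^sub>R b)) a) has_real_derivative
        d a b (p + s *\<^sub>R a + t *\<^sub>R b)) (at t)"
      unfolding d_def
      by (rule has_real_derivative_along_line[OF Ck_on_has_derivative[OF C1 x]])
  qed
  obtain s t where st: "s \<in> {0..h}" "t \<in> {0..h}"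
    and 1: "f (p + h *\<^sub>R u + h *\<^sub>R v) - f (p + h *\<^sub>R u) - f (p + h *\<^sub>R v) + f p
        = h * h * d u v (p + s *\<^sub>R u + t *\<^sub>R v)"
    using D[of u v] by auto
  obtain s' t' where st': "s' \<in> {0..h}" "t' \<in> {0..h}"
    and 2: "f (p + h *\<^sub>R v + h *\<^sub>R u) - f (p + h *\<^sub>R v) - f (p + h *\<^sub>R u) + f p
        = h * h * d v u (p + s' *\<^sub>R v + t' *\<^sub>R u)"
    using D[of v u] by (auto simp: insert_commute)
  have "h * h * d u v (p + s *\<^sub>R u + t *\<^sub>R v) = h * h * d v u (p + s' *\<^sub>R v + t' *\<^sub>R u)"
    using 1 2 unfolding add.assoc add.commute[of "h *\<^sub>R v"] by linarith
  then have eq: "d u v (p + s *\<^sub>R u + t *\<^sub>R v) = d v u (p + s' *\<^sub>R v + t' *\<^sub>R u)"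
    using h by simp
  have "dist (d u v (p + s *\<^sub>R u + t *\<^sub>R v)) (d u v p) < e"
    using near[OF small[OF st, of u v]] by auto
  moreover have "dist (d v u (p + s' *\<^sub>R v + t' *\<^sub>R u)) (d v u p) < e"
    using near[OF small[OF st', of v u]] by auto
  ultimately have "\<bar>d u v p - d v u p\<bar> < 2 * e"
    using eq by (simp add: dist_real_def)
  then show False by (simp add: e_def)
qed

lemma frechet_derivative_linear_compose:
  assumes "bounded_linear L" "f differentiable at x"
  shows "frechet_derivative (\<lambda>y. L (f y)) (at x) = (\<lambda>v. L (frechet_derivative f (at x) v))"
  using frechet_derivative_at[OF bounded_linear.has_derivative[OF assms(1)
        assms(2)[unfolded frechet_derivative_works]]] by simp

lemma second_derivative_symmetric:
  fixes f :: "'a::real_normed_vector \<Rightarrow> 'b::euclidean_space"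
  assumes S: "open S" "p \<in> S" and f: "smooth_on S f"
  shows "frechet_derivative (\<lambda>y. frechet_derivative f (at y) u) (at p) v =
    frechet_derivative (\<lambda>y. frechet_derivative f (at y) v) (at p) u"
proof (rule euclidean_eqI)
  fix b :: 'b assume "b \<in> Basis"
  have bl: "bounded_linear (\<lambda>y::'b. y \<bullet> b)" by (rule bounded_linear_inner_left)
  have diff: "g differentiable at x" if "smooth_on S g" "x \<in> S" for g :: "'a \<Rightarrow> 'b" and x
    using smooth_on_has_derivative[OF that] by (auto simp: differentiable_def)
  have 1: "frechet_derivative (\<lambda>y. frechet_derivative f (at y) w) (at p) z \<bullet> b =
    frechet_derivative (\<lambda>y. frechet_derivative (\<lambda>y. f y \<bullet> b) (at y) w) (at p) z" for w z
  proof -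
    have "((\<lambda>y. frechet_derivative f (at y) w \<bullet> b) has_derivative
        (\<lambda>z. frechet_derivative (\<lambda>y. frechet_derivative f (at y) w) (at p) z \<bullet> b)) (at p)"
      by (intro bounded_linear.has_derivative[OF bl] smooth_on_has_derivative[OF _ S(2)]
          smooth_on_frechet_derivative f)
    then have "((\<lambda>y. frechet_derivative (\<lambda>y. f y \<bullet> b) (at y) w) has_derivative
        (\<lambda>z. frechet_derivative (\<lambda>y. frechet_derivative f (at y) w) (at p) z \<bullet> b)) (at p)"
      by (rule has_derivative_transform_within_open[OF _ S])
        (simp add: frechet_derivative_linear_compose[OF bl diff[OF f]])
    from frechet_derivative_at[OF this] show ?thesis by metis
  qed
  show "frechet_derivative (\<lambda>y. frechet_derivative f (at y) u) (at p) v \<bullet> b =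
    frechet_derivative (\<lambda>y. frechet_derivative f (at y) v) (at p) u \<bullet> b"
    unfolding 1
    by (rule second_derivative_symmetric_real[OF S])
      (intro smooth_onD smooth_on_linear_compose[OF _ bl] S f)
qed

text \<open>The derivative of \<open>dZ(Y)\<close> in direction \<open>v\<close> is \<open>d\<^sup>2Z(Y, v) + dZ(dY(v))\<close>. The Hessian term is written
  with \<open>v\<close> in the inner slot, so that for two fields \<open>X\<close> and \<open>Y\<close> in place of \<open>v\<close> the two Hessian
  terms of a curvature are exchanged by symmetry.\<close>

lemma has_derivative_frechet_derivative_apply:
  fixes Z :: "'a::euclidean_space \<Rightarrow> 'b::euclidean_space"
  assumes S: "open S" "p \<in> S" and Z: "smooth_on S Z" and Y: "smooth_on S Y"
  shows "((\<lambda>q. frechet_derivative Z (at q) (Y q)) has_derivative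
    (\<lambda>v. frechet_derivative (\<lambda>q. frechet_derivative Z (at q) v) (at p) (Y p)
       + frechet_derivative Z (at p) (frechet_derivative Y (at p) v))) (at p)"
proof -
  let ?dZ = "\<lambda>b q. frechet_derivative Z (at q) b" and ?dY = "frechet_derivative Y (at p)"
  have lin: "linear (frechet_derivative Z (at q))" if "q \<in> S" for q
    by (rule has_derivative_linear[OF smooth_on_has_derivative[OF Z that]])
  have sZ: "smooth_on S (?dZ b)" for b by (rule smooth_on_frechet_derivative[OF Z])
  have "((\<lambda>q. \<Sum>b\<in>Basis. (Y q \<bullet> b) *\<^sub>R ?dZ b q) has_derivative
      (\<lambda>v. \<Sum>b\<in>Basis. (Y p \<bullet> b) *\<^sub>R frechet_derivative (?dZ b) (at p) v + (?dY v \<bullet> b) *\<^sub>R ?dZ b p)) (at p)"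
    by (intro has_derivative_sum has_derivative_scaleR has_derivative_inner_left
        smooth_on_has_derivative[OF sZ S(2)] smooth_on_has_derivative[OF Y S(2)])
  then have 1: "((\<lambda>q. ?dZ (Y q) q) has_derivative
      (\<lambda>v. \<Sum>b\<in>Basis. (Y p \<bullet> b) *\<^sub>R frechet_derivative (?dZ b) (at p) v + (?dY v \<bullet> b) *\<^sub>R ?dZ b p)) (at p)"
    by (rule has_derivative_transform_within_open[OF _ S])
      (rule linear_euclidean_expansion[OF lin, symmetric])
  have "(\<Sum>b\<in>Basis. (Y p \<bullet> b) *\<^sub>R frechet_derivative (?dZ b) (at p) v + (?dY v \<bullet> b) *\<^sub>R ?dZ b p)
      = frechet_derivative (?dZ v) (at p) (Y p) + ?dZ (?dY v) p" for v
  proof -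
    have "(\<Sum>b\<in>Basis. (Y p \<bullet> b) *\<^sub>R frechet_derivative (?dZ b) (at p) v)
        = (\<Sum>b\<in>Basis. (Y p \<bullet> b) *\<^sub>R frechet_derivative (?dZ v) (at p) b)"
      by (simp add: second_derivative_symmetric[OF S Z, of _ v])
    also have "\<dots> = frechet_derivative (?dZ v) (at p) (Y p)"
      by (rule linear_euclidean_expansion[symmetric],
          rule has_derivative_linear[OF smooth_on_has_derivative[OF sZ S(2)]])
    finally show ?thesis
      by (simp add: sum.distrib linear_euclidean_expansion[OF lin[OF S(2)], of "?dY v"])
  qed
  then show ?thesis using 1 by simp
qed

section \<open>Vector fields and flatness\<close>

lemma vector_fieldsD:
  assumes "X \<in> vector_fields U"
  shows "smooth_on U X" "p \<notin> U \<Longrightarrow> X p = 0"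
  using assms by (auto simp: vector_fields_def)

lemma vector_fields_has_derivative:
  "X \<in> vector_fields U \<Longrightarrow> p \<in> U \<Longrightarrow> (X has_derivative frechet_derivative X (at p)) (at p)"
  by (rule smooth_on_has_derivative[OF vector_fieldsD(1)])

lemma vector_fields_linear_frechet_derivative:
  "X \<in> vector_fields U \<Longrightarrow> p \<in> U \<Longrightarrow> linear (frechet_derivative X (at p))"
  by (rule has_derivative_linear[OF vector_fields_has_derivative])

lemma vector_fields_restrictI:
  assumes "open U" "smooth_on U X"
  shows "(\<lambda>p. if p \<in> U then X p else 0) \<in> vector_fields U"
  unfolding vector_fields_def
  by (auto intro: smooth_on_cong[OF assms])

lemma vector_fields_scaleR:
  "open U \<Longrightarrow> smooth_on U f \<Longrightarrow> X \<in> vector_fields U \<Longrightarrow> (\<lambda>p. f p *\<^sub>R X p) \<in> vector_fields U"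
  by (auto simp: vector_fields_def intro: smooth_on_scaleR)

lemma vector_fields_lie_bracket:
  assumes "open U" "X \<in> vector_fields U" "Y \<in> vector_fields U"
  shows "lie_bracket U X Y \<in> vector_fields U"
proof -
  have "smooth_on U (\<lambda>p. frechet_derivative W (at p) (V p))"
    if "V \<in> vector_fields U" "W \<in> vector_fields U" for V W
    by (rule smooth_on_frechet_derivative_apply[OF assms(1) vector_fieldsD(1)[OF that(2)]
          smooth_on_linear[OF assms(1) bounded_linear_ident] _ vector_fieldsD(1)[OF that(1)]])
  then show ?thesis
    unfolding lie_bracket_def using assms
    by (intro vector_fields_restrictI smooth_on_diff) auto
qed

text \<open>A connection has meaningful values only on vector fields, so two connections agreeing there need not be
  equal as functions; torsion and curvature nevertheless only see the common values.\<close>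

lemma locally_flat_manifold_cong:
  assumes flat: "locally_flat_manifold U D'"
    and eq: "\<And>X Y. X \<in> vector_fields U \<Longrightarrow> Y \<in> vector_fields U \<Longrightarrow> D X Y = D' X Y"
    and D: "linear_connection U D"
  shows "locally_flat_manifold U D"
proof -
  have U: "open U" using flat by (simp add: locally_flat_manifold_def)
  have D': "D' X Y \<in> vector_fields U" if "X \<in> vector_fields U" "Y \<in> vector_fields U" for X Y
    using flat that by (simp add: locally_flat_manifold_def linear_connection_def)
  have "torsion U D X Y = torsion U D' X Y"
    if "X \<in> vector_fields U" "Y \<in> vector_fields U" for X Y
    using that by (simp add: torsion_def eq)
  moreover have "curvature U D X Y Z = curvature U D' X Y Z"
    if "X \<in> vector_fields U" "Y \<in> vector_fields U" "Z \<in> vector_fields U" for X Y Z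
    using that by (simp add: curvature_def eq D' vector_fields_lie_bracket[OF U])
  ultimately show ?thesis using flat D by (simp add: locally_flat_manifold_def)
qed

section \<open>A family of flat connections\<close>

lemma open_Aff: "open Aff"
proof -
  have "open {p :: real \<times> real. fst p \<noteq> 0}"
    by (intro open_Collect_neq continuous_on_fst continuous_on_id continuous_on_const)
  moreover have "Aff = {p. fst p \<noteq> 0}" by (auto simp: Aff_def)
  ultimately show ?thesis by simp
qed

lemma mem_Aff_iff: "p \<in> Aff \<longleftrightarrow> fst p \<noteq> 0"
  by (auto simp: Aff_def split: prod.splits)

text \<open>The connection on the \<open>(a, b)\<close>-chart whose Christoffel form is \<open>- (k / a) da\<^sup>2\<close> with values in the
  direction \<open>(1, \<alpha>)\<close>. In the linear coordinates \<open>(a, b - \<alpha> a)\<close> it is the product of the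
  connection \<open>- (k / a) da\<^sup>2\<close> of the punctured line with the standard one. For \<open>k = 1\<close> its affine
  coordinates are \<open>(ln \<bar>a\<bar>, b - \<alpha> a)\<close>, and for \<open>k = 1 - t\<close> with \<open>t \<noteq> 0\<close> they are
  \<open>(\<bar>a\<bar>\<^sup>t, b - \<alpha> a)\<close>.\<close>

definition aff_connection :: "real \<Rightarrow> real \<Rightarrow> (real \<times> real) connection" where
  "aff_connection \<alpha> k X Y = (\<lambda>p. if p \<in> Aff then
     frechet_derivative Y (at p) (X p) - (k * (fst (X p) * fst (Y p) * inverse (fst p))) *\<^sub>R (1, \<alpha>) else 0)"

lemma smooth_on_fst: "open S \<Longrightarrow> smooth_on S f \<Longrightarrow> smooth_on S (\<lambda>x. fst (f x))"
  by (rule smooth_on_linear_compose[OF _ bounded_linear_fst])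

lemma smooth_on_snd: "open S \<Longrightarrow> smooth_on S f \<Longrightarrow> smooth_on S (\<lambda>x. snd (f x))"
  by (rule smooth_on_linear_compose[OF _ bounded_linear_snd])

text \<open>The point and the parameter both vary with \<open>x\<close>, so that one argument covers the smoothness of a
  single covariant derivative (\<open>f\<close> the identity, \<open>k\<close> constant) and the joint smoothness of a family
  in the parameter and the point.\<close>

lemma smooth_on_aff_connection:
  assumes S: "open S" and f: "smooth_on S f" "\<And>x. x \<in> S \<Longrightarrow> f x \<in> Aff" and k: "smooth_on S k"
    and X: "X \<in> vector_fields Aff" and Y: "Y \<in> vector_fields Aff"
  shows "smooth_on S (\<lambda>x. aff_connection \<alpha> (k x) X Y (f x))"
proof (rule smooth_on_cong[OF S])
  have c: "smooth_on S (\<lambda>x. V (f x))" if "V \<in> vector_fields Aff" for V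
    by (rule smooth_on_compose[OF S vector_fieldsD(1)[OF that] f])
  show "smooth_on S (\<lambda>x. frechet_derivative Y (at (f x)) (X (f x))
      - (k x * (fst (X (f x)) * fst (Y (f x)) * inverse (fst (f x)))) *\<^sub>R (1, \<alpha>))"
    using f(2)
    by (intro smooth_on_diff smooth_on_frechet_derivative_apply[OF S vector_fieldsD(1)[OF Y]] f
        smooth_on_scaleR smooth_on_mult smooth_on_inverse smooth_on_fst c[OF X] c[OF Y] S k smooth_on_const)
      (simp_all add: mem_Aff_iff)
qed (use f(2) in \<open>simp add: aff_connection_def\<close>)

lemma aff_connection_vector_field:
  assumes "X \<in> vector_fields Aff" "Y \<in> vector_fields Aff"
  shows "aff_connection \<alpha> k X Y \<in> vector_fields Aff"
  using smooth_on_aff_connection[OF open_Aff smooth_on_linear[OF open_Aff bounded_linear_ident] _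
      smooth_on_const[OF open_Aff] assms, of \<alpha> k]
  by (simp add: vector_fields_def) (simp add: aff_connection_def)

lemma linear_connection_aff_connection: "linear_connection Aff (aff_connection \<alpha> k)"
  unfolding linear_connection_def
proof (intro conjI ballI allI impI)
  fix X Y assume X: "X \<in> vector_fields Aff" and Y: "Y \<in> vector_fields Aff"
  show "aff_connection \<alpha> k X Y \<in> vector_fields Aff" by (rule aff_connection_vector_field[OF X Y])
next
  fix X X' Y assume Y: "Y \<in> vector_fields Aff"
  show "aff_connection \<alpha> k (\<lambda>p. X p + X' p) Y = (\<lambda>p. aff_connection \<alpha> k X Y p + aff_connection \<alpha> k X' Y p)"
    using linear_add[OF vector_fields_linear_frechet_derivative[OF Y]]
    by (auto simp: aff_connection_def fun_eq_iff algebra_simps)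
next
  fix X Y Y' assume Y: "Y \<in> vector_fields Aff" and Y': "Y' \<in> vector_fields Aff"
  have "frechet_derivative (\<lambda>p. Y p + Y' p) (at p) =
      (\<lambda>v. frechet_derivative Y (at p) v + frechet_derivative Y' (at p) v)" if "p \<in> Aff" for p
    by (rule frechet_derivative_at[symmetric])
      (intro has_derivative_add vector_fields_has_derivative[OF Y that] vector_fields_has_derivative[OF Y' that])
  then show "aff_connection \<alpha> k X (\<lambda>p. Y p + Y' p) = (\<lambda>p. aff_connection \<alpha> k X Y p + aff_connection \<alpha> k X Y' p)"
    by (intro ext) (simp add: aff_connection_def algebra_simps)
next
  fix f :: "real \<times> real \<Rightarrow> real" and X Y
  assume Y: "Y \<in> vector_fields Aff"
  show "aff_connection \<alpha> k (\<lambda>p. f p *\<^sub>R X p) Y = (\<lambda>p. f p *\<^sub>R aff_connection \<alpha> k X Y p)"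
    using linear_cmul[OF vector_fields_linear_frechet_derivative[OF Y]]
    by (auto simp: aff_connection_def fun_eq_iff algebra_simps)
next
  fix f :: "real \<times> real \<Rightarrow> real" and X Y
  assume f: "smooth_on Aff f" and Y: "Y \<in> vector_fields Aff"
  have "frechet_derivative (\<lambda>p. f p *\<^sub>R Y p) (at p) =
      (\<lambda>v. f p *\<^sub>R frechet_derivative Y (at p) v + frechet_derivative f (at p) v *\<^sub>R Y p)" if "p \<in> Aff" for p
    by (rule frechet_derivative_at[symmetric])
      (intro has_derivative_scaleR vector_fields_has_derivative[OF Y that] smooth_on_has_derivative[OF f that])
  then show "aff_connection \<alpha> k X (\<lambda>p. f p *\<^sub>R Y p) =
      (\<lambda>p. frechet_derivative f (at p) (X p) *\<^sub>R Y p + f p *\<^sub>R aff_connection \<alpha> k X Y p)"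
    using vector_fieldsD(2)[OF Y]
    by (intro ext) (simp add: aff_connection_def algebra_simps)
qed

lemma frechet_derivative_aff_connection:
  assumes p: "p \<in> Aff" and Y: "Y \<in> vector_fields Aff" and Z: "Z \<in> vector_fields Aff"
  shows "frechet_derivative (aff_connection \<alpha> k Y Z) (at p) =
    (\<lambda>v. frechet_derivative (\<lambda>q. frechet_derivative Z (at q) v) (at p) (Y p)
       + frechet_derivative Z (at p) (frechet_derivative Y (at p) v)
       - (k * ((fst (Y p) * fst (frechet_derivative Z (at p) v)
             + fst (frechet_derivative Y (at p) v) * fst (Z p)) * inverse (fst p)
           - fst (Y p) * fst (Z p) * (inverse (fst p) * fst v * inverse (fst p)))) *\<^sub>R (1, \<alpha>))"
    (is "_ = ?F")
proof (rule frechet_derivative_at[symmetric])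
  have f: "((\<lambda>q. fst (V q)) has_derivative (\<lambda>v. fst (frechet_derivative V (at p) v))) (at p)"
    if "V \<in> vector_fields Aff" for V
    by (intro has_derivative_fst vector_fields_has_derivative[OF that p])
  have i: "((\<lambda>q::real \<times> real. inverse (fst q)) has_derivative
      (\<lambda>v. - (inverse (fst p) * fst v * inverse (fst p)))) (at p)"
    using p by (intro Deriv.has_derivative_inverse has_derivative_fst has_derivative_ident)
      (simp add: mem_Aff_iff)
  have 2: "((\<lambda>q. (k * (fst (Y q) * fst (Z q) * inverse (fst q))) *\<^sub>R (1::real, \<alpha>)) has_derivative
      (\<lambda>v. (k * ((fst (Y p) * fst (Z p)) * - (inverse (fst p) * fst v * inverse (fst p))
         + (fst (Y p) * fst (frechet_derivative Z (at p) v)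
             + fst (frechet_derivative Y (at p) v) * fst (Z p)) * inverse (fst p))) *\<^sub>R (1, \<alpha>))) (at p)"
    by (intro has_derivative_scaleR_left has_derivative_mult_right has_derivative_mult f Y Z i)
  have "((\<lambda>q. frechet_derivative Z (at q) (Y q) -
      (k * (fst (Y q) * fst (Z q) * inverse (fst q))) *\<^sub>R (1, \<alpha>)) has_derivative ?F) (at p)"
    by (rule has_derivative_eq_rhs[OF has_derivative_diff[OF has_derivative_frechet_derivative_apply[OF open_Aff p
          vector_fieldsD(1)[OF Z] vector_fieldsD(1)[OF Y]] 2]])
      (simp add: algebra_simps)
  then show "(aff_connection \<alpha> k Y Z has_derivative ?F) (at p)"
    by (rule has_derivative_transform_within_open[OF _ open_Aff p]) (simp add: aff_connection_def)
qed

lemma torsion_aff_connection: "torsion Aff (aff_connection \<alpha> k) X Y = (\<lambda>p. 0)"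
  by (auto simp: torsion_def aff_connection_def lie_bracket_def fun_eq_iff algebra_simps)

text \<open>After expansion at a point, the Hessian terms cancel by symmetry, the terms containing \<open>dX\<close> and \<open>dY\<close>
  combine to the derivative along the bracket, and the rest is symmetric in \<open>X\<close> and \<open>Y\<close>: since the
  Christoffel form is a function of \<open>a\<close> times \<open>da\<^sup>2\<close>, every term containing it
  depends on \<open>X\<close> and \<open>Y\<close> only through \<open>da\<close>.\<close>

lemma curvature_aff_connection:
  assumes X: "X \<in> vector_fields Aff" and Y: "Y \<in> vector_fields Aff" and Z: "Z \<in> vector_fields Aff"
  shows "curvature Aff (aff_connection \<alpha> k) X Y Z = (\<lambda>p. 0)"
proof
  fix p
  show "curvature Aff (aff_connection \<alpha> k) X Y Z p = 0"
  proof (cases "p \<in> Aff")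
    case True
    let ?H = "\<lambda>v w. frechet_derivative (\<lambda>q. frechet_derivative Z (at q) v) (at p) w"
    have a: "fst p \<noteq> 0" using True by (simp add: mem_Aff_iff)
    have sym: "?H (X p) (Y p) = ?H (Y p) (X p)"
      by (rule second_derivative_symmetric[OF open_Aff True vector_fieldsD(1)[OF Z]])
    have dZ: "frechet_derivative Z (at p) (v - w) = frechet_derivative Z (at p) v - frechet_derivative Z (at p) w" for v w
      by (rule linear_diff[OF vector_fields_linear_frechet_derivative[OF Z True]])
    have val: "aff_connection \<alpha> k V W p = frechet_derivative W (at p) (V p)
        - (k * (fst (V p) * fst (W p) * inverse (fst p))) *\<^sub>R (1, \<alpha>)" for V W
      using True by (simp add: aff_connection_def)
    have br: "lie_bracket Aff X Y p = frechet_derivative Y (at p) (X p) - frechet_derivative X (at p) (Y p)"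
      using True by (simp add: lie_bracket_def)
    show ?thesis
      unfolding curvature_def val frechet_derivative_aff_connection[OF True Y Z]
        frechet_derivative_aff_connection[OF True X Z] br dZ sym
      by (simp add: prod_eq_iff algebra_simps)
  next
    case False
    then show ?thesis by (simp add: curvature_def aff_connection_def)
  qed
qed

lemma locally_flat_aff_connection: "locally_flat_manifold Aff (aff_connection \<alpha> k)"
  by (simp add: locally_flat_manifold_def open_Aff linear_connection_aff_connection
      torsion_aff_connection curvature_aff_connection)

lemma smooth_connection_family_aff_connection:
  "smooth_connection_family Aff UNIV (\<lambda>t. aff_connection \<alpha> (1 - t))"
  unfolding smooth_connection_family_def
proof (intro ballI)
  fix X Y assume XY: "X \<in> vector_fields Aff" "Y \<in> vector_fields Aff"
  have o: "open ((UNIV :: real set) \<times> Aff)" by (intro open_Times open_UNIV open_Aff)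
  have "smooth_on (UNIV \<times> Aff) (\<lambda>z :: real \<times> real \<times> real. aff_connection \<alpha> (1 - fst z) X Y (snd z))"
    by (intro smooth_on_aff_connection[OF o _ _ _ XY] smooth_on_diff smooth_on_const
        smooth_on_linear bounded_linear_fst bounded_linear_snd o) auto
  then show "smooth_on (UNIV \<times> Aff) (\<lambda>(t, p). aff_connection \<alpha> (1 - t) X Y p)"
    by (simp add: case_prod_unfold)
qed

section \<open>The given connection in the chart\<close>

lemma aff_mult_inv_into:
  assumes "g \<in> Aff"
  shows "inv_into Aff (aff_mult g) g = (1, 0)"
proof -
  have "inj_on (aff_mult g) Aff"
    using assms by (auto simp: inj_on_def aff_mult_def mem_Aff_iff prod_eq_iff)
  from inv_into_f_f[OF this, of "(1, 0)"] show ?thesis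
    by (simp add: mem_Aff_iff aff_mult_def)
qed

text \<open>Left translation by \<open>g\<close> is affine with linear part multiplication by \<open>fst g\<close>, and it carries the unit
  \<open>(1, 0)\<close> to \<open>g\<close>. Off the group \<open>fst p = 0\<close>, so one formula also gives the value \<open>0\<close> there.\<close>

lemma left_invariant_field_eq:
  assumes "X \<in> left_invariant_fields"
  shows "X = (\<lambda>p. fst p *\<^sub>R X (1, 0))"
proof
  fix g
  show "X g = fst g *\<^sub>R X (1, 0)"
  proof (cases "g \<in> Aff")
    case True
    have "(aff_mult g has_derivative (\<lambda>v. fst g *\<^sub>R v)) (at x)" for x
    proof -
      have "((\<lambda>h. fst g *\<^sub>R h + (0, snd g)) has_derivative (\<lambda>v. fst g *\<^sub>R v)) (at x)"
        by (auto intro!: derivative_eq_intros)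
      moreover have "(\<lambda>h. fst g *\<^sub>R h + (0, snd g)) = aff_mult g"
        by (auto simp: aff_mult_def fun_eq_iff)
      ultimately show ?thesis by simp
    qed
    from frechet_derivative_at[OF this]
    have d: "frechet_derivative (aff_mult g) (at x) = (\<lambda>v. fst g *\<^sub>R v)" for x by metis
    have "X g = pushforward Aff (aff_mult g) X g"
      using assms True by (simp add: left_invariant_fields_def)
    then show ?thesis using True by (simp add: pushforward_def d aff_mult_inv_into)
  next
    case False
    then show ?thesis
      using assms vector_fieldsD(2)[of X Aff g]
      by (simp add: left_invariant_fields_def mem_Aff_iff)
  qed
qed

text \<open>For \<open>e1 = a v\<close> and \<open>e2 = a w\<close> the bracket at the unit is \<open>v\<^sub>1 w - w\<^sub>1 v\<close>; as \<open>v\<close> and \<open>w\<close> are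
  linearly independent, it equals \<open>w\<close> only for \<open>v\<^sub>1 = 1\<close> and \<open>w\<^sub>1 = 0\<close>. The parameters \<open>\<alpha>\<close> and \<open>\<beta>\<close>
  are the remaining freedom, coming from automorphisms of the Lie algebra.\<close>

lemma left_invariant_basis_coordinates:
  assumes basis: "left_invariant_basis e1 e2" and br: "lie_bracket Aff e1 e2 = e2"
  obtains \<alpha> \<beta> where "\<beta> \<noteq> 0" "e1 = (\<lambda>p. fst p *\<^sub>R (1, \<alpha>))" "e2 = (\<lambda>p. fst p *\<^sub>R (0, \<beta>))"
proof -
  define v where "v = e1 (1, 0)"
  define w where "w = e2 (1, 0)"
  have e1: "e1 = (\<lambda>p. fst p *\<^sub>R v)" and e2: "e2 = (\<lambda>p. fst p *\<^sub>R w)"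
    using basis left_invariant_field_eq unfolding left_invariant_basis_def v_def w_def by blast+
  have indep: "c = 0 \<and> d = 0" if "c *\<^sub>R v + d *\<^sub>R w = 0" for c d
  proof -
    have "c *\<^sub>R e1 p + d *\<^sub>R e2 p = 0" for p
    proof -
      have "c *\<^sub>R e1 p + d *\<^sub>R e2 p = fst p *\<^sub>R (c *\<^sub>R v + d *\<^sub>R w)"
        unfolding e1 e2 by (simp add: algebra_simps)
      then show ?thesis using that by simp
    qed
    then show ?thesis using basis unfolding left_invariant_basis_def by blast
  qed
  have d: "frechet_derivative (\<lambda>p::real \<times> real. fst p *\<^sub>R u) (at x) = (\<lambda>v. fst v *\<^sub>R u)" for u :: "real \<times> real" and x
    by (rule frechet_derivative_at[symmetric]) (auto intro!: derivative_eq_intros)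
  have "lie_bracket Aff e1 e2 (1, 0) = fst v *\<^sub>R w - fst w *\<^sub>R v"
    by (simp add: lie_bracket_def e1 e2 d mem_Aff_iff)
  then have "fst v *\<^sub>R w - fst w *\<^sub>R v = w" by (simp add: br w_def)
  then have "(- fst w) *\<^sub>R v + (fst v - 1) *\<^sub>R w = 0" by (simp add: algebra_simps)
  from indep[OF this] have vw: "fst v = 1" "fst w = 0" by auto
  have "snd w \<noteq> 0"
  proof
    assume "snd w = 0"
    then have "w = 0" using vw by (simp add: prod_eq_iff)
    then show False using indep[of 0 1] by simp
  qed
  moreover have "v = (1, snd v)" "w = (0, snd w)" using vw by (simp_all add: prod_eq_iff)
  ultimately show thesis using that e1 e2 by metis
qed

text \<open>Every vector field is a combination of \<open>e1\<close> and \<open>e2\<close> with smooth coefficients, so function linearity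
  and the Leibniz rule determine the connection from its values on the frame.\<close>

lemma connection_eq_aff_connection:
  assumes D: "linear_connection Aff D" and \<beta>: "\<beta> \<noteq> 0"
    and e1_def: "e1 = (\<lambda>p. fst p *\<^sub>R (1, \<alpha>))" and e2_def: "e2 = (\<lambda>p. fst p *\<^sub>R (0, \<beta>))"
    and D11: "D e1 e1 = (\<lambda>p. 0)" and D12: "D e1 e2 = e2" and D21: "D e2 e1 = (\<lambda>p. 0)" and D22: "D e2 e2 = (\<lambda>p. 0)"
    and X: "X \<in> vector_fields Aff" and Y: "Y \<in> vector_fields Aff"
  shows "D X Y = aff_connection \<alpha> 1 X Y"
proof -
  have add_left: "D (\<lambda>p. A p + A' p) B = (\<lambda>p. D A B p + D A' B p)"
    and add_right: "D B (\<lambda>p. A p + A' p) = (\<lambda>p. D B A p + D B A' p)"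
    and scale_left: "smooth_on Aff f \<Longrightarrow> D (\<lambda>p. f p *\<^sub>R A p) B = (\<lambda>p. f p *\<^sub>R D A B p)"
    and scale_right: "smooth_on Aff f \<Longrightarrow> D B (\<lambda>p. f p *\<^sub>R A p) =
      (\<lambda>p. frechet_derivative f (at p) (B p) *\<^sub>R A p + f p *\<^sub>R D B A p)"
    if "A \<in> vector_fields Aff" "A' \<in> vector_fields Aff" "B \<in> vector_fields Aff" for A A' B f
    using D that unfolding linear_connection_def by blast+
  have field: "(\<lambda>p::real \<times> real. fst p *\<^sub>R u) \<in> vector_fields Aff" for u :: "real \<times> real"
    using smooth_on_scaleR[OF open_Aff smooth_on_linear[OF open_Aff bounded_linear_fst]
        smooth_on_const[OF open_Aff]]
    by (simp add: vector_fields_def mem_Aff_iff)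
  have e: "e1 \<in> vector_fields Aff" "e2 \<in> vector_fields Aff"
    unfolding e1_def e2_def by (rule field)+
  \<comment> \<open>The coefficients of a field with respect to \<open>e1\<close> and \<open>e2\<close>.\<close>
  define x1 where "x1 V p = fst (V p) * inverse (fst p)" for V :: "real \<times> real \<Rightarrow> real \<times> real" and p
  define x2 where "x2 V p = (snd (V p) - \<alpha> * fst (V p)) * inverse (\<beta> * fst p)" for V :: "real \<times> real \<Rightarrow> real \<times> real" and p
  have s: "smooth_on Aff (x1 V)" "smooth_on Aff (x2 V)" if "V \<in> vector_fields Aff" for V
    unfolding x1_def[abs_def] x2_def[abs_def] using \<beta>
    by (intro smooth_on_mult smooth_on_inverse smooth_on_diff smooth_on_fst smooth_on_snd
        smooth_on_const smooth_on_linear bounded_linear_ident vector_fieldsD(1)[OF that] open_Aff;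
        simp add: mem_Aff_iff)+
  have dec: "(\<lambda>p. x1 V p *\<^sub>R e1 p + x2 V p *\<^sub>R e2 p) = V" if "V \<in> vector_fields Aff" for V
  proof
    fix p
    show "x1 V p *\<^sub>R e1 p + x2 V p *\<^sub>R e2 p = V p"
      using vector_fieldsD(2)[OF that, of p] \<beta>
      by (cases "p \<in> Aff") (auto simp: x1_def x2_def e1_def e2_def mem_Aff_iff prod_eq_iff field_simps)
  qed
  have f: "(\<lambda>p. x1 V p *\<^sub>R e1 p) \<in> vector_fields Aff" "(\<lambda>p. x2 V p *\<^sub>R e2 p) \<in> vector_fields Aff"
    if "V \<in> vector_fields Aff" for V
    by (intro vector_fields_scaleR open_Aff s that e)+
  have DX: "D X B = (\<lambda>p. x1 X p *\<^sub>R D e1 B p + x2 X p *\<^sub>R D e2 B p)" if "B \<in> vector_fields Aff" for B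
    using add_left[OF f[OF X] that] scale_left[OF e(1) e(1) that s(1)[OF X]] scale_left[OF e(2) e(2) that s(2)[OF X]]
    by (simp add: dec[OF X])
  have DXe: "D X e1 = (\<lambda>p. 0)" "D X e2 = (\<lambda>p. x1 X p *\<^sub>R e2 p)"
    using DX[OF e(1)] DX[OF e(2)] by (simp_all add: D11 D12 D21 D22)
  have DXY: "D X Y = (\<lambda>p. frechet_derivative (x1 Y) (at p) (X p) *\<^sub>R e1 p
      + (frechet_derivative (x2 Y) (at p) (X p) *\<^sub>R e2 p + x2 Y p *\<^sub>R x1 X p *\<^sub>R e2 p))"
    using add_right[OF f[OF Y] X] scale_right[OF e(1) e(1) X s(1)[OF Y]] scale_right[OF e(2) e(2) X s(2)[OF Y]]
    by (simp add: dec[OF Y] DXe)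
  show ?thesis
  proof
    fix p
    show "D X Y p = aff_connection \<alpha> 1 X Y p"
    proof (cases "p \<in> Aff")
      case True
      then have a: "fst p \<noteq> 0" by (simp add: mem_Aff_iff)
      have b: "\<beta> * fst p \<noteq> 0" using a \<beta> by simp
      let ?dY = "frechet_derivative Y (at p)"
      note dY = vector_fields_has_derivative[OF Y True]
      have "(x1 Y has_derivative (\<lambda>v. fst (?dY v) / fst p - fst (Y p) * fst v / (fst p)\<^sup>2)) (at p)"
        unfolding x1_def[abs_def]
        by (rule derivative_eq_intros dY refl a)+ (use a in \<open>simp add: fun_eq_iff field_simps power2_eq_square\<close>)
      note d1 = frechet_derivative_at[OF this, symmetric]
      have "(x2 Y has_derivative (\<lambda>v. (snd (?dY v) - \<alpha> * fst (?dY v)) / (\<beta> * fst p)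
          - (snd (Y p) - \<alpha> * fst (Y p)) * fst v / (\<beta> * (fst p)\<^sup>2))) (at p)"
        unfolding x2_def[abs_def]
        by (rule derivative_eq_intros dY refl b)+
          (use a \<beta> in \<open>simp_all add: fun_eq_iff field_simps power2_eq_square\<close>)
      note d2 = frechet_derivative_at[OF this, symmetric]
      show ?thesis
        unfolding DXY d1 d2 using True a \<beta>
        by (simp add: aff_connection_def e1_def e2_def x1_def x2_def prod_eq_iff field_simps power2_eq_square)
    next
      case False
      then show ?thesis
        unfolding DXY by (simp add: aff_connection_def e1_def e2_def mem_Aff_iff zero_prod_def)
    qed
  qed
qed

section \<open>Completeness as an invariant\<close>

lemma diffeoD:
  assumes "diffeo U \<phi>"
  shows "p \<in> U \<Longrightarrow> \<phi> p \<in> U" "q \<in> U \<Longrightarrow> inv_into U \<phi> q \<in> U"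
    and "p \<in> U \<Longrightarrow> inv_into U \<phi> (\<phi> p) = p" "q \<in> U \<Longrightarrow> \<phi> (inv_into U \<phi> q) = q"
    and "smooth_on U \<phi>" "smooth_on U (inv_into U \<phi>)"
  using assms unfolding diffeo_def
  by (auto simp: bij_betw_apply inv_into_into bij_betw_imp_surj_on bij_betw_inv_into_left bij_betw_inv_into_right)

lemma frechet_derivative_left_inverse:
  assumes U: "open U" and f: "smooth_on U f" "\<And>x. x \<in> U \<Longrightarrow> f x \<in> U" and g: "smooth_on U g"
    and gf: "\<And>x. x \<in> U \<Longrightarrow> g (f x) = x" and x: "x \<in> U"
  shows "frechet_derivative g (at (f x)) (frechet_derivative f (at x) v) = v"
proof -
  have "(g \<circ> f has_derivative frechet_derivative g (at (f x)) \<circ> frechet_derivative f (at x)) (at x)"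
    by (intro diff_chain_at smooth_on_has_derivative[OF f(1) x] smooth_on_has_derivative[OF g f(2)[OF x]])
  then have "((\<lambda>x. x) has_derivative frechet_derivative g (at (f x)) \<circ> frechet_derivative f (at x)) (at x)"
    by (rule has_derivative_transform_within_open[OF _ U x]) (simp add: gf)
  from frechet_derivative_at[OF this] show ?thesis by (metis comp_apply frechet_derivative_ident)
qed

text \<open>The pullback of \<open>X\<close> under \<open>\<phi>\<close> is again a smooth field, and it realises \<open>X\<close> as a pushforward; this
  allows the isomorphism condition, stated for pushforwards, to be applied to a
  prescribed field on the target.\<close>

lemma vector_field_pullback:
  assumes U: "open U" and \<phi>: "diffeo U \<phi>" and X: "X \<in> vector_fields U"
  defines "E \<equiv> \<lambda>p. if p \<in> U then frechet_derivative (inv_into U \<phi>) (at (\<phi> p)) (X (\<phi> p)) else 0"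
  shows "E \<in> vector_fields U" "pushforward U \<phi> E = X"
proof -
  note \<phi>D = diffeoD[OF \<phi>]
  show "E \<in> vector_fields U"
    unfolding E_def
    by (intro vector_fields_restrictI U smooth_on_frechet_derivative_apply[OF U \<phi>D(6)] \<phi>D
        smooth_on_compose[OF U vector_fieldsD(1)[OF X]])
  show "pushforward U \<phi> E = X"
  proof
    fix q
    show "pushforward U \<phi> E q = X q"
    proof (cases "q \<in> U")
      case True
      have "frechet_derivative \<phi> (at (inv_into U \<phi> q)) (frechet_derivative (inv_into U \<phi>) (at q) (X q)) = X q"
        by (rule frechet_derivative_left_inverse[OF U \<phi>D(6,2,5,4) True])
      then show ?thesis using True by (simp add: pushforward_def E_def \<phi>D)
    qed (use vector_fieldsD(2)[OF X] in \<open>simp add: pushforward_def\<close>)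
  qed
qed

lemma pushforward_eq_0_imp:
  assumes U: "open U" and \<phi>: "diffeo U \<phi>" and E: "pushforward U \<phi> E = (\<lambda>q. 0)" and p: "p \<in> U"
  shows "E p = 0"
proof -
  note \<phi>D = diffeoD[OF \<phi>]
  have "pushforward U \<phi> E (\<phi> p) = frechet_derivative \<phi> (at p) (E p)"
    using p by (simp add: pushforward_def \<phi>D)
  then have z: "frechet_derivative \<phi> (at p) (E p) = 0" using E by simp
  have "E p = frechet_derivative (inv_into U \<phi>) (at (\<phi> p)) (frechet_derivative \<phi> (at p) (E p))"
    by (rule frechet_derivative_left_inverse[OF U \<phi>D(5,1,6,3) p, symmetric])
  also have "\<dots> = 0"
    unfolding z
    by (rule linear_0[OF has_derivative_linear[OF smooth_on_has_derivative[OF \<phi>D(6) \<phi>D(1)[OF p]]]])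
  finally show ?thesis .
qed

text \<open>For the parameter \<open>1 - t\<close> with \<open>t \<noteq> 0\<close> the function \<open>\<bar>a\<bar>\<^sup>t\<close> is affine, hence has zero second derivative
  along every geodesic. Along one that starts transversally to the \<open>b\<close>-direction it is a nonconstant
  affine function of time, yet it is positive; so such a geodesic cannot be defined for all time.
  Here geodesics appear as integral curves of a field \<open>E\<close> with \<open>D\<^sub>E E = 0\<close>, which lets
  a connection given on vector fields speak about them.\<close>

lemma incomplete_geodesic:
  assumes E: "E \<in> vector_fields Aff"
    and geo: "\<And>p. p \<in> Aff \<Longrightarrow> aff_connection \<alpha> (1 - t) E E p = 0"
    and \<gamma>: "\<And>s. \<gamma> s \<in> Aff" "\<And>s. (\<gamma> has_vector_derivative E (\<gamma> s)) (at s)"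
    and init: "fst (\<gamma> 0) = 1" "fst (E (\<gamma> 0)) = 1"
  shows "t = 0"
proof (rule ccontr)
  assume t: "t \<noteq> 0"
  define a where "a s = fst (\<gamma> s)" for s
  define A where "A s = fst (E (\<gamma> s))" for s
  \<comment> \<open>This is \<open>\<bar>a s\<bar>\<^sup>t\<close>, in a form that is differentiable for either sign of \<open>a s\<close>.\<close>
  define h where "h s = (a s)\<^sup>2 powr (t / 2)" for s
  have a0: "a s \<noteq> 0" for s using \<gamma>(1)[of s] by (simp add: a_def mem_Aff_iff)
  have da: "(a has_real_derivative A s) (at s)" for s
    using bounded_linear.has_vector_derivative[OF bounded_linear_fst \<gamma>(2)[of s]]
    by (simp add: a_def[abs_def] A_def has_real_derivative_iff_has_vector_derivative)
  have dA: "(A has_real_derivative (1 - t) * (A s)\<^sup>2 / a s) (at s)" for s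
  proof -
    have "frechet_derivative E (at (\<gamma> s)) (E (\<gamma> s))
        = ((1 - t) * (fst (E (\<gamma> s)) * fst (E (\<gamma> s)) * inverse (fst (\<gamma> s)))) *\<^sub>R (1, \<alpha>)"
      using geo[OF \<gamma>(1)[of s]] \<gamma>(1)[of s] by (simp add: aff_connection_def)
    then have "fst (frechet_derivative E (at (\<gamma> s)) (E (\<gamma> s))) = (1 - t) * (A s)\<^sup>2 / a s"
      by (simp add: A_def a_def power2_eq_square divide_inverse)
    moreover have "(E \<circ> \<gamma> has_vector_derivative frechet_derivative E (at (\<gamma> s)) (E (\<gamma> s))) (at s)"
      by (rule vector_derivative_diff_chain_within[OF \<gamma>(2)])
        (rule has_derivative_at_withinI[OF vector_fields_has_derivative[OF E \<gamma>(1)]])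
    ultimately show ?thesis
      using bounded_linear.has_vector_derivative[OF bounded_linear_fst]
      by (fastforce simp: A_def[abs_def] has_real_derivative_iff_has_vector_derivative)
  qed
  have dh: "(h has_real_derivative t * (h s * A s / a s)) (at s)" for s
  proof -
    have "((\<lambda>s. (a s)\<^sup>2) has_real_derivative 2 * a s * A s) (at s)"
      by (auto intro!: derivative_eq_intros da)
    moreover have "(a s)\<^sup>2 > 0" using a0[of s] by simp
    ultimately have "(h has_real_derivative
        (a s)\<^sup>2 powr (t / 2) * (0 * ln ((a s)\<^sup>2) + 2 * a s * A s * (t / 2) / (a s)\<^sup>2)) (at s)"
      unfolding h_def[abs_def] by (rule DERIV_powr[OF _ _ DERIV_const])
    then
    show ?thesis using a0[of s] by (simp add: h_def power2_eq_square field_simps)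
  qed
  have "((\<lambda>s. h s * A s / a s) has_real_derivative 0) (at s)" for s
    by (rule derivative_eq_intros dh dA da a0 refl)+
      (use a0[of s] in \<open>simp add: field_simps power2_eq_square\<close>)
  then have "h s * A s / a s = h 0 * A 0 / a 0" for s
    by (intro DERIV_isconst_all) auto
  also have "\<dots> = 1" using init by (simp add: a_def A_def h_def)
  finally have one: "h s * A s / a s = 1" for s .
  have "(h has_real_derivative t) (at s)" for s
    using dh[of s] unfolding one by simp
  then have "((\<lambda>s. h s - t * s) has_real_derivative 0) (at s)" for s
    by (auto intro!: derivative_eq_intros)
  then have "h s - t * s = h 0 - t * 0" for s
    by (intro DERIV_isconst_all) auto
  \<comment> \<open>\<open>h\<close> is the function \<open>1 + t s\<close>, which vanishes at \<open>s = - 1 / t\<close>.\<close>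
  from this[of "- 1 / t"] have "h (- 1 / t) = 0"
    using t init by (simp add: h_def a_def)
  then show False using a0[of "- 1 / t"] by (simp add: h_def)
qed

text \<open>The field \<open>X\<close> has constant coefficients in the coordinates \<open>(ln \<bar>a\<bar>, b - \<alpha> a)\<close>, each of which ranges
  over the whole line on either component of the group; hence its flow is defined for all time.\<close>

lemma complete_flow:
  fixes \<alpha> l m :: real and q :: "real \<times> real"
  assumes q: "q \<in> Aff"
  defines "X \<equiv> \<lambda>p. if p \<in> Aff then (l * fst p, l * \<alpha> * fst p + m) else 0"
  obtains c where "c 0 = q" "\<And>s. c s \<in> Aff" "\<And>s. (c has_vector_derivative X (c s)) (at s)"
proof -
  define c where "c s = (fst q * exp (l * s), snd q + \<alpha> * fst q * (exp (l * s) - 1) + m * s)" for s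
  have A: "c s \<in> Aff" for s using q by (simp add: c_def mem_Aff_iff)
  have "(c has_vector_derivative (l * (fst q * exp (l * s)), l * \<alpha> * (fst q * exp (l * s)) + m)) (at s)" for s
    unfolding c_def[abs_def]
    by (auto intro!: has_vector_derivative_Pair derivative_eq_intros
        simp: has_real_derivative_iff_has_vector_derivative[symmetric])
  then have "(c has_vector_derivative X (c s)) (at s)" for s
    using A[of s] by (simp add: X_def) (simp add: c_def)
  then show thesis using that[of c] A by (simp add: c_def)
qed

text \<open>Parallel, as it has constant coefficients in the affine coordinates \<open>(ln \<bar>a\<bar>, b - \<alpha> a)\<close>. Varying \<open>l\<close>
  and \<open>m\<close>, these fields take every value at any given point.\<close>

lemma parallel_field:
  fixes \<alpha> l m :: real
  defines "X \<equiv> \<lambda>p. if p \<in> Aff then (l * fst p, l * \<alpha> * fst p + m) else 0"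
  shows "X \<in> vector_fields Aff" "aff_connection \<alpha> 1 X X = (\<lambda>p. 0)"
proof -
  have "smooth_on Aff (\<lambda>p. fst p *\<^sub>R (l, l * \<alpha>) + (0, m))"
    by (rule smooth_on_add[OF open_Aff smooth_on_scaleR[OF open_Aff
          smooth_on_linear[OF open_Aff bounded_linear_fst]] ]) (rule smooth_on_const[OF open_Aff])+
  then have "smooth_on Aff (\<lambda>p. (l * fst p, l * \<alpha> * fst p + m))"
    by (rule smooth_on_cong[OF open_Aff]) (simp add: algebra_simps)
  then show "X \<in> vector_fields Aff"
    unfolding X_def by (rule vector_fields_restrictI[OF open_Aff])
  have "(X has_derivative (\<lambda>v. (l * fst v, l * \<alpha> * fst v))) (at p)" if "p \<in> Aff" for p
  proof -
    have "((\<lambda>p. (l * fst p, l * \<alpha> * fst p + m)) has_derivative (\<lambda>v. (l * fst v, l * \<alpha> * fst v))) (at p)"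
      for p :: "real \<times> real"
      by (auto intro!: derivative_eq_intros)
    then show ?thesis
      by (rule has_derivative_transform_within_open[OF _ open_Aff that]) (simp add: X_def)
  qed
  note d = frechet_derivative_at[OF this, symmetric]
  show "aff_connection \<alpha> 1 X X = (\<lambda>p. 0)"
    by (auto simp: aff_connection_def fun_eq_iff d) (auto simp: X_def mem_Aff_iff field_simps zero_prod_def)
qed

text \<open>Completeness distinguishes the connections. Choose a parallel field of \<open>D\<close> whose pullback under a
  supposed isomorphism points in the \<open>a\<close>-direction at the unit. An integral curve of it exists for all time
  and pulls back to a complete geodesic of the deformed connection, of a kind excluded
  by \<open>incomplete_geodesic\<close>.\<close>

lemma not_isomorphic_aff_connection:
  assumes t: "t \<noteq> 0"
    and D: "\<And>X Y. X \<in> vector_fields Aff \<Longrightarrow> Y \<in> vector_fields Aff \<Longrightarrow> D X Y = aff_connection \<alpha> 1 X Y"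
  shows "\<not> isomorphic_connections Aff (aff_connection \<alpha> (1 - t)) D"
proof
  assume "isomorphic_connections Aff (aff_connection \<alpha> (1 - t)) D"
  then obtain \<phi> where \<phi>: "diffeo Aff \<phi>"
    and carries: "carries_connection Aff \<phi> (aff_connection \<alpha> (1 - t)) D"
    by (auto simp: isomorphic_connections_def)
  note \<phi>D = diffeoD[OF \<phi>]
  let ?\<psi> = "inv_into Aff \<phi>"
  have p: "(1, 0) \<in> Aff" by (simp add: mem_Aff_iff)
  define V where "V = frechet_derivative \<phi> (at (1, 0)) (1, 0)"
  define q where "q = \<phi> (1, 0)"
  have q: "q \<in> Aff" unfolding q_def by (rule \<phi>D(1)[OF p])
  \<comment> \<open>The values of \<open>l\<close> and \<open>m\<close> for which the parallel field equals \<open>V\<close> at \<open>q\<close>.\<close>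
  define l where "l = fst V / fst q"
  define m where "m = snd V - \<alpha> * fst V"
  define X where "X = (\<lambda>p. if p \<in> Aff then (l * fst p, l * \<alpha> * fst p + m) else 0)"
  have X: "X \<in> vector_fields Aff" "aff_connection \<alpha> 1 X X = (\<lambda>p. 0)"
    using parallel_field unfolding X_def by blast+
  have Xq: "X q = V" using q by (simp add: X_def l_def m_def mem_Aff_iff prod_eq_iff)
  define E where "E = (\<lambda>p. if p \<in> Aff then frechet_derivative ?\<psi> (at (\<phi> p)) (X (\<phi> p)) else 0)"
  have E: "E \<in> vector_fields Aff" "pushforward Aff \<phi> E = X"
    using vector_field_pullback[OF open_Aff \<phi> X(1)] unfolding E_def by blast+
  have "D X X = pushforward Aff \<phi> (aff_connection \<alpha> (1 - t) E E)"
    using carries E by (auto simp: carries_connection_def)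
  then have push0: "pushforward Aff \<phi> (aff_connection \<alpha> (1 - t) E E) = (\<lambda>q. 0)"
    using X by (simp add: D)
  obtain c where c: "c 0 = q" "\<And>s. c s \<in> Aff" "\<And>s. (c has_vector_derivative X (c s)) (at s)"
    using complete_flow[OF q] unfolding X_def by blast
  have "t = 0"
  proof (rule incomplete_geodesic[OF E(1) pushforward_eq_0_imp[OF open_Aff \<phi> push0], of "?\<psi> \<circ> c"])
    show "(?\<psi> \<circ> c) s \<in> Aff" for s using c(2) \<phi>D(2) by simp
    show "(?\<psi> \<circ> c has_vector_derivative E ((?\<psi> \<circ> c) s)) (at s)" for s
      using vector_derivative_diff_chain_within[OF c(3)
          has_derivative_at_withinI[OF smooth_on_has_derivative[OF \<phi>D(6) c(2)]]]
      by (simp add: E_def c(2) \<phi>D)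
    have "(?\<psi> \<circ> c) 0 = (1, 0)" by (simp add: c(1) q_def \<phi>D(3)[OF p])
    moreover have "E (1, 0) = (1, 0)"
      using frechet_derivative_left_inverse[OF open_Aff \<phi>D(5,1,6,3) p, of "(1, 0)"] p Xq
      by (simp add: E_def q_def V_def)
    ultimately show "fst ((?\<psi> \<circ> c) 0) = 1" "fst (E ((?\<psi> \<circ> c) 0)) = 1" by simp_all
  qed
  then show False using t by simp
qed

section \<open>Non trivial deformations\<close>

theorem corollary8p1:
  fixes e1 e2 :: "real \<times> real \<Rightarrow> real \<times> real"
    and D :: "(real \<times> real) connection"
  assumes "left_invariant_basis e1 e2"
    and "lie_bracket Aff e1 e2 = e2"
    and "left_invariant_connection D"
    and "\<And>l m l' m' :: real.
           D (\<lambda>p. l *\<^sub>R e1 p + m *\<^sub>R e2 p) (\<lambda>p. l' *\<^sub>R e1 p + m' *\<^sub>R e2 p) =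
             (\<lambda>p. (l * m') *\<^sub>R e2 p)"
  shows "locally_flat_manifold Aff D \<and> (\<exists>I Dt. nontrivial_deformation Aff D I Dt)"
proof -
  obtain \<alpha> \<beta> where e: "\<beta> \<noteq> 0" "e1 = (\<lambda>p. fst p *\<^sub>R (1, \<alpha>))" "e2 = (\<lambda>p. fst p *\<^sub>R (0, \<beta>))"
    by (rule left_invariant_basis_coordinates[OF assms(1,2)])
  have lin: "linear_connection Aff D" using assms(3) by (simp add: left_invariant_connection_def)
  have eq: "D X Y = aff_connection \<alpha> 1 X Y" if "X \<in> vector_fields Aff" "Y \<in> vector_fields Aff" for X Y
    by (rule connection_eq_aff_connection[OF lin e _ _ _ _ that])
      (use assms(4)[of 1 0 1 0] assms(4)[of 1 0 0 1] assms(4)[of 0 1 1 0] assms(4)[of 0 1 0 1] in simp_all)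
  have "locally_flat_manifold Aff D"
    by (rule locally_flat_manifold_cong[OF locally_flat_aff_connection eq lin])
  moreover have "nontrivial_deformation Aff D UNIV (\<lambda>t. aff_connection \<alpha> (1 - t))"
    unfolding nontrivial_deformation_def deformation_def
  proof (intro conjI ballI allI impI)
    fix \<epsilon> :: real assume "\<epsilon> > 0"
    then show "\<exists>t\<in>UNIV. \<bar>t\<bar> < \<epsilon> \<and> \<not> isomorphic_connections Aff (aff_connection \<alpha> (1 - t)) D"
      by (intro bexI[of _ "\<epsilon> / 2"] conjI not_isomorphic_aff_connection eq) auto
  qed (simp_all add: smooth_connection_family_aff_connection locally_flat_aff_connection eq)
  ultimately show ?thesis by blast
qed

end
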